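(* Let $X$ be a locally connected strong Fréchet topological space, let $Y$ be a Hausdorff topological space, and let $f:X\to Y$ be a function. Then $f$ is continuous if and only if $f$ is compact-preserving and has the Darboux property.
   Context: A function $f:X\to Y$ between topological spaces is compact-preserving if the image $f(K)$ of each compact subset $K\subset X$ is compact; it has the Darboux property if the image $f(C)$ of each connected subset $C\subset X$ is connected. Compact means that every open cover has a finite subcover (no separation axiom included). A topological space $X$ is strong Fréchet if for any decreasing sequence $(A_n)_{n\in\omega}$ of subsets of $X$ and any point $a\in\bigcap_{n\in\omega}\bar A_n$ there is a sequence of points $a_n\in A_n$, $n\in\omega$, that converges to $a$. *)

theory Defs
  imports "HOL-Analysis.Analysis"
begin

definition compact_preserving :: "'a topology \<Rightarrow> 'b topology \<Rightarrow> ('a \<Rightarrow> 'b) \<Rightarrow> bool" where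
  "compact_preserving X Y f \<longleftrightarrow> (\<forall>K. compactin X K \<longrightarrow> compactin Y (f ` K))"

definition darboux_property :: "'a topology \<Rightarrow> 'b topology \<Rightarrow> ('a \<Rightarrow> 'b) \<Rightarrow> bool" where
  "darboux_property X Y f \<longleftrightarrow> (\<forall>C. connectedin X C \<longrightarrow> connectedin Y (f ` C))"

definition strong_frechet_space :: "'a topology \<Rightarrow> bool" where
  "strong_frechet_space X \<longleftrightarrow>
     (\<forall>(A :: nat \<Rightarrow> 'a set) a.
        (\<forall>n. A n \<subseteq> topspace X) \<longrightarrow> decseq A \<longrightarrow> a \<in> (\<Inter>n. X closure_of A n) \<longrightarrow>
        (\<exists>s. (\<forall>n. s n \<in> A n) \<and> limitin X s a sequentially))"

end

theory Submission
  imports Defs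
begin

text \<open>
  If \<open>f\<close> is compact-preserving and \<open>s\<close> converges to \<open>a\<close> while \<open>f \<circ> s\<close> avoids a neighbourhood \<open>V\<close>
  of \<open>f a\<close>, then \<open>f \<circ> s\<close> takes only finitely many values: otherwise these values accumulate at some
  \<open>y \<noteq> f a\<close>, and deleting from \<open>s\<close> the terms that are mapped to \<open>y\<close> yields a compact set whose image
  is not closed. The strong Frechet property upgrades this from sequences to neighbourhoods: near \<open>a\<close>
  all values of \<open>f\<close> outside \<open>V\<close> belong to a finite set. A connected image that contains \<open>f a\<close> cannot
  meet this finite set away from \<open>f a\<close>.
\<close>

lemma compact_preserving_finite_range:
  assumes kc: "kc_space Y" and f: "compact_preserving X Y f"
    and lim: "limitin X s a sequentially" and s: "range s \<subseteq> topspace X"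
    and V: "openin Y V" "f a \<in> V" and avoid: "\<And>n. f (s n) \<notin> V"
  shows "finite (range (f \<circ> s))"
proof (rule ccontr)
  assume inf: "infinite (range (f \<circ> s))"
  \<comment> \<open>Every neighbourhood of \<open>a\<close> contains almost all terms of
    \<open>s\<close>, so \<open>a\<close> together with any set of terms is compact.\<close>
  have image_closed: "closedin Y (f ` insert a S)" if "S \<subseteq> range s" for S
    using compactin_sequence_with_limit [OF lim that] that s f kc
    unfolding compact_preserving_def kc_space_def by blast
  have "compactin Y (f ` insert a (range s))"
    using compactin_sequence_with_limit [OF lim order_refl s] f
    unfolding compact_preserving_def by blast
  then obtain y where y: "y \<in> Y derived_set_of (range (f \<circ> s))"
    using compactin_imp_Bolzano_Weierstrass [of Y "f ` insert a (range s)" "range (f \<circ> s)"] inf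
    by auto
  have "y \<noteq> f a"
    using y V avoid unfolding in_derived_set_of by (metis comp_apply rangeE)
  define S where "S = {x \<in> range s. f x \<noteq> y}"
  \<comment> \<open>Accumulation at \<open>y\<close> is witnessed by values other than
    \<open>y\<close>, so deleting the fibre over \<open>y\<close> keeps \<open>y\<close> in the
    closure.\<close>
  have "y \<in> Y closure_of (f ` insert a S)"
    unfolding in_closure_of
  proof (intro conjI allI impI)
    show "y \<in> topspace Y"
      using y by (simp add: in_derived_set_of)
    fix T assume "y \<in> T \<and> openin Y T"
    then obtain n where "f (s n) \<noteq> y" "f (s n) \<in> T"
      using y unfolding in_derived_set_of by (metis comp_apply rangeE)
    then show "\<exists>z. z \<in> f ` insert a S \<and> z \<in> T"
      by (auto simp: S_def)
  qed
  moreover have "closedin Y (f ` insert a S)"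
    by (rule image_closed) (auto simp: S_def)
  ultimately have "y \<in> f ` insert a S"
    by (simp add: closure_of_closedin)
  then show False
    using \<open>y \<noteq> f a\<close> by (auto simp: S_def)
qed

text \<open>The strong Frechet property enters twice: with a decreasing sequence of sets to show
  that \<open>F\<close> is finite, and with a constant one to find \<open>U\<close>.\<close>

lemma compact_preserving_locally_finite_deviation:
  assumes X: "strong_frechet_space X" and kc: "kc_space Y"
    and f: "compact_preserving X Y f"
    and a: "a \<in> topspace X" and V: "openin Y V" "f a \<in> V"
  obtains U F where "openin X U" "a \<in> U" "finite F" "F \<inter> V = {}" "f ` U \<subseteq> V \<union> F"
proof -
  have seq: "\<exists>s. (\<forall>n. s n \<in> A n) \<and> limitin X s a sequentially"
    if "\<And>n. A n \<subseteq> topspace X" "decseq A" "\<And>n. a \<in> X closure_of A n" for A :: "nat \<Rightarrow> 'a set"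
    using X that unfolding strong_frechet_space_def by blast
  \<comment> \<open>Every neighbourhood of \<open>a\<close> attains these values, so any exceptional
    set has to contain them.\<close>
  define F where "F = {y. y \<notin> V \<and> a \<in> X closure_of {x \<in> topspace X. f x = y}}"
  have "finite F"
  proof (rule ccontr)
    assume "infinite F"
    then obtain y :: "nat \<Rightarrow> 'b" where y: "inj y" "range y \<subseteq> F"
      using infinite_countable_subset by blast
    \<comment> \<open>Because of the tails \<open>{n..}\<close>, any choice of \<open>s n\<close> in
      \<open>A n\<close> hits values of index at least \<open>n\<close>, hence infinitely many
      distinct ones.\<close>
    define A where "A n = {x \<in> topspace X. f x \<in> y ` {n..}}" for n
    have "decseq A"
      by (fastforce simp: A_def decseq_def)
    moreover have "a \<in> X closure_of A n" for n
    proof -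
      have "{x \<in> topspace X. f x = y n} \<subseteq> A n"
        by (auto simp: A_def)
      moreover have "a \<in> X closure_of {x \<in> topspace X. f x = y n}"
        using y by (auto simp: F_def)
      ultimately show ?thesis
        using closure_of_mono by blast
    qed
    ultimately obtain s where s: "\<And>n. s n \<in> A n" "limitin X s a sequentially"
      using seq [of A] by (auto simp: A_def)
    obtain m where m: "\<And>n. f (s n) = y (m n)" "\<And>n. n \<le> m n"
      using s(1) unfolding A_def by (simp add: image_iff Bex_def) metis
    have "finite (range (f \<circ> s))"
      by (rule compact_preserving_finite_range [OF kc f s(2) _ V])
        (use s(1) y(2) m(1) in \<open>auto simp: A_def F_def\<close>)
    moreover have "range (f \<circ> s) = y ` range m"
      using m(1) by auto
    ultimately have "finite (range m)"
      using y(1) by (metis finite_imageD inj_on_subset subset_UNIV)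
    then obtain k where "\<And>n. m n \<le> k"
      by (auto simp: finite_nat_set_iff_bounded_le)
    then show False
      using m(2) [of "Suc k"] not_less_eq_eq order_trans by blast
  qed
  define B where "B = {x \<in> topspace X. f x \<notin> V \<union> F}"
  have "a \<notin> X closure_of B"
  proof
    assume "a \<in> X closure_of B"
    then obtain s where s: "\<And>n. s n \<in> B" "limitin X s a sequentially"
      using seq [of "\<lambda>_. B"] by (auto simp: B_def decseq_def)
    have "finite (range (f \<circ> s))"
      by (rule compact_preserving_finite_range [OF kc f s(2) _ V])
        (use s(1) in \<open>auto simp: B_def\<close>)
    \<comment> \<open>A value taken infinitely often has a fibre that accumulates at
      \<open>a\<close>, so it belongs to \<open>F\<close>, although \<open>B\<close> excludes such
      values.\<close>
    then obtain n where n: "infinite {k. (f \<circ> s) k = (f \<circ> s) n}"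
      using pigeonhole_infinite [of UNIV "f \<circ> s"] by auto
    have "a \<in> X closure_of {x \<in> topspace X. f x = f (s n)}"
      unfolding in_closure_of
    proof (intro conjI allI impI a)
      fix U assume "a \<in> U \<and> openin X U"
      then obtain N where N: "\<And>k. N \<le> k \<Longrightarrow> s k \<in> U"
        using s(2) unfolding limitin_sequentially by blast
      obtain k where "N \<le> k" "f (s k) = f (s n)"
        using n by (auto simp: infinite_nat_iff_unbounded_le)
      then show "\<exists>x. x \<in> {x \<in> topspace X. f x = f (s n)} \<and> x \<in> U"
        using N s(1) by (auto simp: B_def)
    qed
    then show False
      using s(1) [of n] by (auto simp: B_def F_def)
  qed
  then obtain U where U: "openin X U" "a \<in> U" "U \<inter> B = {}"
    using a unfolding in_closure_of by blast
  show thesis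
  proof
    show "f ` U \<subseteq> V \<union> F"
      using U openin_subset [OF U(1)] by (auto simp: B_def)
  qed (use U \<open>finite F\<close> in \<open>auto simp: F_def\<close>)
qed

text \<open>Local finiteness of the deviation is applied twice: \<open>V\<close> yields the finite
  set \<open>F\<close>, and then a neighbourhood \<open>W\<close> of \<open>f a\<close>, separated
  from \<open>F\<close> by an open set \<open>G\<close>, yields \<open>F'\<close>.\<close>

lemma compact_preserving_darboux_imp_continuous_map:
  assumes X: "locally_connected_space X" "strong_frechet_space X" and Y: "Hausdorff_space Y"
    and f: "f \<in> topspace X \<rightarrow> topspace Y" "compact_preserving X Y f" "darboux_property X Y f"
  shows "continuous_map X Y f"
  unfolding continuous_map_eq_topcontinuous_at topcontinuous_at_def
proof (intro ballI conjI allI impI f(1))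
  fix a V
  assume a: "a \<in> topspace X" and V: "openin Y V \<and> f a \<in> V"
  note deviation = compact_preserving_locally_finite_deviation
    [OF X(2) Hausdorff_imp_kc_space [OF Y] f(2) a]
  obtain U F where U: "openin X U" "a \<in> U" and F: "finite F" "F \<inter> V = {}" "f ` U \<subseteq> V \<union> F"
    using deviation V by metis
  \<comment> \<open>\<open>F\<close> comes with no bound by \<open>topspace Y\<close>; the
    intersection still contains every value of \<open>f\<close> on \<open>U\<close> outside
    \<open>V\<close>.\<close>
  have "compactin Y {f a}" "compactin Y (F \<inter> topspace Y)" "disjnt {f a} (F \<inter> topspace Y)"
    using a f(1) F V by (auto simp: finite_imp_compactin_eq disjnt_def)
  then obtain W G where W: "openin Y W" "f a \<in> W" and G: "openin Y G" "F \<inter> topspace Y \<subseteq> G"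
    and disj: "disjnt W G"
    using Y unfolding Hausdorff_space_compact_sets by (metis insert_subset)
  obtain U' F' where U': "openin X U'" "a \<in> U'" and F': "finite F'" "f ` U' \<subseteq> W \<union> F'"
    using deviation W by metis
  obtain C where C: "openin X C" "connectedin X C" "a \<in> C" "C \<subseteq> U \<inter> U'"
    using X(1) U U' unfolding locally_connected_space by (metis IntI openin_Int)
  have conn: "connectedin Y (f ` C)"
    using f(3) C(2) unfolding darboux_property_def by blast
  have sub: "f ` C \<subseteq> topspace Y"
    using conn connectedin_subset_topspace by blast
  define D where "D = f ` C \<inter> G"
  have "D \<subseteq> F'"
    using C F' disj by (fastforce simp: D_def disjnt_def)
  then have "closedin Y D"
    using Y F'(1) sub by (auto simp: D_def intro: closedin_Hausdorff_finite finite_subset)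
  then have "openin Y (topspace Y - D)"
    by blast
  moreover have "f ` C \<subseteq> (topspace Y - D) \<union> G" "(topspace Y - D) \<inter> G \<inter> f ` C = {}"
    using sub by (auto simp: D_def)
  moreover have "(topspace Y - D) \<inter> f ` C \<noteq> {}"
    using C(3) W(2) disj sub by (auto simp: D_def disjnt_def)
  ultimately have "G \<inter> f ` C = {}"
    using conn G(1) unfolding connectedin by blast
  then have "f ` C \<subseteq> V"
    using C(4) F(3) G(2) sub by fast
  then show "\<exists>U. openin X U \<and> a \<in> U \<and> (\<forall>y\<in>U. f y \<in> V)"
    using C by blast
qed

theorem corollary2:
  fixes X :: "'a topology" and Y :: "'b topology" and f :: "'a \<Rightarrow> 'b"
  assumes "locally_connected_space X" and "strong_frechet_space X"
    and "Hausdorff_space Y"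
    and "f \<in> topspace X \<rightarrow> topspace Y"
  shows "continuous_map X Y f \<longleftrightarrow> compact_preserving X Y f \<and> darboux_property X Y f"
  using compact_preserving_darboux_imp_continuous_map [OF assms]
  by (auto simp: compact_preserving_def darboux_property_def
      intro: image_compactin connectedin_continuous_map_image)

end
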